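(* Let $I,J$ be positive integers and let $A$ be the model matrix of the independence model for $I\times J$ contingency tables. Let $\tilde A$ be the matrix produced by summing up two distinct columns of $A$ that are either both row indicators of the table, or both column indicators of the table (the two columns are replaced by their sum). Then $$\mathcal{I}(\tilde A)=\mathcal{I}(A)+\mathcal{J},$$ where $\mathcal{J}$ is an ideal generated by linear binomials. More precisely, if the summed columns are the indicator vectors of columns $a$ and $b$ of the table, then $\mathcal{J}$ contains all the binomials $p_{i,a}-p_{i,b}$ for all $i=1,\ldots,I$.
   Context: The cells of an $I\times J$ table are the pairs $(i,j)$ with $1\le i\le I$, $1\le j\le J$, ordered lexicographically. The model matrix of the independence model is the $IJ\times(1+I+J)$ matrix $A=[\mathbf{1},r_1,\ldots,r_I,c_1,\ldots,c_J]$ with rows indexed by the cells, where $\mathbf{1}$ is the column vector of ones, $r_i$ is the $0/1$ indicator vector of the cells in the $i$-th row of the table, and $c_j$ is the $0/1$ indicator vector of the cells in the $j$-th column of the table. For a matrix $M$ with non-negative integer entries $m_{(i,j),s}$, rows indexed by the cells and columns by $s=0,\ldots,t$, the toric ideal $\mathcal{I}(M)\subset\mathbb{R}[p_{i,j}: 1\le i\le I,\,1\le j\le J]$ is the ideal of all polynomials vanishing on the image of the map $\mathbb{R}^{t+1}\to\mathbb{R}^{IJ}$ whose $(i,j)$ coordinate is $\prod_{s=0}^t\zeta_s^{m_{(i,j),s}}$; equivalently, it is the kernel of the ring homomorphism $\mathbb{R}[p_{i,j}]\to\mathbb{R}[\zeta_0,\ldots,\zeta_t]$, $p_{i,j}\mapsto\prod_{s=0}^t\zeta_s^{m_{(i,j),s}}$.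 A linear binomial is a polynomial of the form $p_{i,j}-p_{h,k}$. *)

theory Defs
  imports Complex_Main "HOL-Library.Poly_Mapping" "HOL-Algebra.Ideal"
begin

type_synonym cell = "nat \<times> nat"

definition cells :: "nat \<Rightarrow> nat \<Rightarrow> cell set"
  where "cells I J = {1..I} \<times> {1..J}"

text \<open>
  The ring \<open>\<real>[p\<^sub>i\<^sub>,\<^sub>j]\<close> over the cells of an \<open>I \<times> J\<close> table. Polynomials are finitely supported
  maps from exponent vectors to coefficients, with convolution as multiplication. The type allows an indeterminate for every pair of naturals, so
  the ring is cut out as the set of polynomials in the indeterminates of the table only. In this
  way \<open>I\<close> and \<open>J\<close> stay ordinary natural numbers.
\<close>

type_synonym mpoly = "(cell \<Rightarrow>\<^sub>0 nat) \<Rightarrow>\<^sub>0 real"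

definition vars :: "mpoly \<Rightarrow> cell set"
  where "vars f = (\<Union>m \<in> Poly_Mapping.keys f. Poly_Mapping.keys m)"

definition table_ring :: "nat \<Rightarrow> nat \<Rightarrow> mpoly ring"
  where "table_ring I J =
    \<lparr>carrier = {f. vars f \<subseteq> cells I J}, monoid.mult = (*), one = 1, zero = 0, add = (+)\<rparr>"

definition indet :: "cell \<Rightarrow> mpoly"
  where "indet c = Poly_Mapping.single (Poly_Mapping.single c 1) 1"

definition poly_eval :: "(cell \<Rightarrow> real) \<Rightarrow> mpoly \<Rightarrow> real"
  where "poly_eval x f =
    (\<Sum>m \<in> Poly_Mapping.keys f.
      Poly_Mapping.lookup f m * (\<Prod>c \<in> Poly_Mapping.keys m. x c ^ Poly_Mapping.lookup m c))"

definition linear_binomials :: "nat \<Rightarrow> nat \<Rightarrow> mpoly set"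
  where "linear_binomials I J = {indet c - indet d | c d. c \<in> cells I J \<and> d \<in> cells I J}"

text \<open>
  A matrix with rows indexed by the cells is the list of its columns. Column number \<open>s\<close> (counted
  from \<open>0\<close>) of \<open>M\<close> is \<open>M ! s\<close>; the values of a column outside the table play no role below.
\<close>

type_synonym cell_matrix = "(cell \<Rightarrow> nat) list"

definition row_indicator :: "nat \<Rightarrow> cell \<Rightarrow> nat"
  where "row_indicator i c = of_bool (fst c = i)"

definition column_indicator :: "nat \<Rightarrow> cell \<Rightarrow> nat"
  where "column_indicator j c = of_bool (snd c = j)"

definition independence_matrix :: "nat \<Rightarrow> nat \<Rightarrow> cell_matrix"
  where "independence_matrix I J =
    (\<lambda>c. 1) # map row_indicator [1..<Suc I] @ map column_indicator [1..<Suc J]"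

text \<open>Thus the row indicators sit at positions \<open>1..I\<close>, the column indicators at \<open>I + 1..I + J\<close>.\<close>

lemma independence_matrix_nth:
  shows "length (independence_matrix I J) = 1 + I + J"
    and "independence_matrix I J ! 0 = (\<lambda>c. 1)"
    and "i \<in> {1..I} \<Longrightarrow> independence_matrix I J ! i = row_indicator i"
    and "j \<in> {1..J} \<Longrightarrow> independence_matrix I J ! (I + j) = column_indicator j"
  unfolding independence_matrix_def by (auto simp: nth_Cons' nth_append simp del: upt_Suc)

text \<open>
  The columns \<open>s\<close> and \<open>s'\<close> are removed and their sum is put in front of the remaining columns;
  its position is immaterial, as it only amounts to a renaming of the parameters.
\<close>

definition sum_columns :: "nat \<Rightarrow> nat \<Rightarrow> cell_matrix \<Rightarrow> cell_matrix"
  where "sum_columns s s' M = (\<lambda>c. (M ! s) c + (M ! s') c) # nths M (- {s, s'})"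

definition monomial_map :: "cell_matrix \<Rightarrow> (nat \<Rightarrow> real) \<Rightarrow> cell \<Rightarrow> real"
  where "monomial_map M \<zeta> c = (\<Prod>s < length M. \<zeta> s ^ (M ! s) c)"

definition toric_ideal :: "nat \<Rightarrow> nat \<Rightarrow> cell_matrix \<Rightarrow> mpoly set"
  where "toric_ideal I J M =
    {f \<in> carrier (table_ring I J). \<forall>\<zeta>. poly_eval (monomial_map M \<zeta>) f = 0}"

lemma vars_add: "vars (f + g) \<subseteq> vars f \<union> vars g"
  using Poly_Mapping.keys_add[of f g] unfolding vars_def by blast

lemma vars_mult: "vars (f * g) \<subseteq> vars f \<union> vars g"
proof
  fix c assume "c \<in> vars (f * g)"
  then obtain m where m: "m \<in> Poly_Mapping.keys (f * g)" "c \<in> Poly_Mapping.keys m"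
    unfolding vars_def by blast
  with Poly_Mapping.keys_mult[of f g] obtain a b where
    "m = a + b" "a \<in> Poly_Mapping.keys f" "b \<in> Poly_Mapping.keys g" by blast
  with m Poly_Mapping.keys_add[of a b] show "c \<in> vars f \<union> vars g"
    unfolding vars_def by blast
qed

lemma table_ring_cring: "cring (table_ring I J)"
proof -
  let ?P = "\<lambda>f. vars f \<subseteq> cells I J"
  have add: "?P (f + g)" if "?P f" "?P g" for f g
    using vars_add[of f g] that by blast
  have mult: "?P (f * g)" if "?P f" "?P g" for f g
    using vars_mult[of f g] that by blast
  have zero: "?P 0" and one: "?P 1" and minus: "?P (- f) = ?P f" for f
    by (simp_all add: vars_def)
  have neg: "\<exists>g. ?P g \<and> f + g = 0" if "?P f" for f
    using that minus[of f] by (intro exI[of _ "- f"]) simp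
  have "abelian_group (table_ring I J)"
    by (rule abelian_groupI) (simp_all add: table_ring_def add zero neg add.assoc add.commute)
  moreover have "comm_monoid (table_ring I J)"
    by (rule comm_monoidI) (simp_all add: table_ring_def mult one mult.assoc mult.commute)
  ultimately show ?thesis
    by (rule cringI) (simp add: table_ring_def distrib_right)
qed

end

theory Submission
  imports Defs
begin

text \<open>
  Let \<open>M\<close> be the model matrix, and let \<open>s\<close> and \<open>s'\<close> be the two summed columns. The image of the
  monomial map of the summed matrix consists of the points \<open>monomial_map M \<zeta>\<close> with \<open>\<zeta> s = \<zeta> s'\<close>
  (\<open>range_monomial_map_sum_columns\<close>). It is contained in the image for \<open>M\<close>, hence the toric ideal can
  only grow.

  Say that \<open>s\<close> and \<open>s'\<close> are the indicators of the columns \<open>a\<close> and \<open>b\<close> of the table, and let \<open>\<phi>\<close> be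
  the map on cells that moves \<open>(i, a)\<close> to \<open>(i, b)\<close> and fixes all other cells. The binomials
  \<open>p\<^sub>c - p\<^bsub>\<phi> c\<^esub>\<close> vanish wherever \<open>\<zeta> s = \<zeta> s'\<close>, and they generate the ideal that has to be added.
  Indeed, let \<open>f\<close> vanish on the image of the summed matrix. Replacing every indeterminate \<open>p\<^sub>c\<close> by
  \<open>p\<^bsub>\<phi> c\<^esub>\<close> changes \<open>f\<close> by an element of the ideal generated by the binomials
  (\<open>substitute_modulo_binomials\<close>). The value of the result at \<open>monomial_map M \<zeta>\<close>, for any \<open>\<zeta>\<close>, is the
  value of \<open>f\<close> at the point where \<open>\<zeta> s\<close> has been replaced by \<open>\<zeta> s'\<close>; this point lies in the image of
  the summed matrix, so the value is \<open>0\<close>. Thus the result belongs to the toric ideal of \<open>M\<close>.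

  The argument is carried out in \<open>toric_ideal_sum_columns\<close> for any matrix and any map \<open>\<phi>\<close> of the
  cells that shifts the exponents of column \<open>s\<close> to column \<open>s'\<close>. Rows of the table are treated in the
  same way as columns.
\<close>

section \<open>Evaluation of polynomials\<close>

lemma poly_mapping_plus_single_induct [case_names zero plus_single]:
  assumes "P 0"
    and "\<And>f k v. k \<notin> Poly_Mapping.keys f \<Longrightarrow> v \<noteq> 0 \<Longrightarrow> P f \<Longrightarrow> P (f + Poly_Mapping.single k v)"
  shows "P f"
proof (induction f rule: update_induct)
  case const
  show ?case by (rule assms(1))
next
  case (update f k v)
  have "Poly_Mapping.update k v f = f + Poly_Mapping.single k v"
    using update.hyps
    by (intro poly_mapping_eqI)
      (auto simp: lookup_update lookup_add lookup_single when_def in_keys_iff)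
  with assms(2) update show ?case by metis
qed

definition monomial_value :: "(cell \<Rightarrow> real) \<Rightarrow> (cell \<Rightarrow>\<^sub>0 nat) \<Rightarrow> real"
  where "monomial_value x m = (\<Prod>c \<in> Poly_Mapping.keys m. x c ^ Poly_Mapping.lookup m c)"

lemma monomial_value_superset:
  assumes "finite C" "Poly_Mapping.keys m \<subseteq> C"
  shows "monomial_value x m = (\<Prod>c \<in> C. x c ^ Poly_Mapping.lookup m c)"
  unfolding monomial_value_def
  using assms by (intro prod.mono_neutral_left) (auto simp: in_keys_iff)

lemma monomial_value_add: "monomial_value x (m + n) = monomial_value x m * monomial_value x n"
proof -
  let ?C = "Poly_Mapping.keys m \<union> Poly_Mapping.keys n"
  have "monomial_value x k = (\<Prod>c \<in> ?C. x c ^ Poly_Mapping.lookup k c)"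
    if "Poly_Mapping.keys k \<subseteq> ?C" for k
    using that by (intro monomial_value_superset) auto
  with Poly_Mapping.keys_add[of m n] show ?thesis
    by (simp add: lookup_add power_add prod.distrib)
qed

lemma poly_eval_monomial_value:
  "poly_eval x f = (\<Sum>m \<in> Poly_Mapping.keys f. Poly_Mapping.lookup f m * monomial_value x m)"
  by (simp add: poly_eval_def monomial_value_def)

lemma poly_eval_single [simp]: "poly_eval x (Poly_Mapping.single m a) = a * monomial_value x m"
  by (simp add: poly_eval_monomial_value)

lemma poly_eval_indet [simp]: "poly_eval x (indet c) = x c"
  by (simp add: indet_def monomial_value_def)

lemma poly_eval_zero [simp]: "poly_eval x 0 = 0"
  by (simp add: poly_eval_def)

lemma poly_eval_add [simp]: "poly_eval x (f + g) = poly_eval x f + poly_eval x g"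
  unfolding poly_eval_monomial_value
  by (rule setsum_keys_plus_distrib) (simp_all add: distrib_right)

lemma poly_eval_uminus [simp]: "poly_eval x (- f) = - poly_eval x f"
  using poly_eval_add[of x f "- f"] by simp

lemma poly_eval_diff [simp]: "poly_eval x (f - g) = poly_eval x f - poly_eval x g"
  using poly_eval_add[of x f "- g"] by simp

lemma poly_eval_mult [simp]: "poly_eval x (f * g) = poly_eval x f * poly_eval x g"
proof (induction f rule: poly_mapping_plus_single_induct)
  case (plus_single f m a)
  have "poly_eval x (Poly_Mapping.single m a * g) = a * monomial_value x m * poly_eval x g"
    by (induction g rule: poly_mapping_plus_single_induct)
      (simp_all add: distrib_left mult_single monomial_value_add)
  with plus_single.IH show ?case by (simp add: distrib_right)
qed simp

lemma poly_eval_cong: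
  assumes "\<And>c. c \<in> vars f \<Longrightarrow> x c = y c"
  shows "poly_eval x f = poly_eval y f"
proof -
  have "monomial_value x m = monomial_value y m" if "m \<in> Poly_Mapping.keys f" for m
    unfolding monomial_value_def
  proof (rule prod.cong)
    fix c assume "c \<in> Poly_Mapping.keys m"
    with that have "c \<in> vars f" by (auto simp: vars_def)
    then show "x c ^ Poly_Mapping.lookup m c = y c ^ Poly_Mapping.lookup m c"
      by (simp only: assms)
  qed simp
  then show ?thesis by (simp add: poly_eval_monomial_value)
qed

section \<open>Ideals of the ring of a table\<close>

lemma table_ring_simps [simp]:
  "f \<in> carrier (table_ring I J) \<longleftrightarrow> vars f \<subseteq> cells I J"
  "f \<otimes>\<^bsub>table_ring I J\<^esub> g = f * g"
  "f \<oplus>\<^bsub>table_ring I J\<^esub> g = f + g"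
  "\<one>\<^bsub>table_ring I J\<^esub> = 1"
  "\<zero>\<^bsub>table_ring I J\<^esub> = 0"
  by (simp_all add: table_ring_def)

lemma vars_zero [simp]: "vars 0 = {}"
  and vars_uminus [simp]: "vars (- f) = vars f"
  and vars_indet [simp]: "vars (indet c) = {c}"
  by (simp_all add: vars_def indet_def)

lemma vars_diff: "vars (f - g) \<subseteq> vars f \<union> vars g"
  using vars_add[of f "- g"] by simp

lemma table_ring_uminus:
  assumes "vars f \<subseteq> cells I J"
  shows "\<ominus>\<^bsub>table_ring I J\<^esub> f = - f"
proof -
  interpret cring "table_ring I J" by (rule table_ring_cring)
  show ?thesis
    using assms by (intro minus_equality) simp_all
qed

lemma ideal_table_ring_zero: "0 \<in> K" if "ideal K (table_ring I J)"
  using additive_subgroup.zero_closed[OF ideal.axioms(1)[OF that]] by simp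

lemma ideal_table_ring_add: "f + g \<in> K"
  if "ideal K (table_ring I J)" "f \<in> K" "g \<in> K"
  using additive_subgroup.a_closed[OF ideal.axioms(1)[OF that(1)] that(2,3)] by simp

text \<open>
  The polynomials in the indeterminates of \<open>C\<close> form the \<open>\<real>\<close>-algebra generated by these
  indeterminates. This principle reduces a statement about all polynomials to the generators, so
  that substitutions need not be computed monomial by monomial.
\<close>

lemma vars_induct [consumes 1, case_names const indet add mult]:
  assumes "vars f \<subseteq> C"
    and const: "\<And>a. P (Poly_Mapping.single 0 a)"
    and indet: "\<And>c. c \<in> C \<Longrightarrow> P (indet c)"
    and add: "\<And>f g. P f \<Longrightarrow> P g \<Longrightarrow> P (f + g)"
    and mult: "\<And>f g. P f \<Longrightarrow> P g \<Longrightarrow> P (f * g)"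
  shows "P f"
  using assms(1)
proof (induction f rule: poly_mapping_plus_single_induct)
  case zero
  show ?case using const[of 0] by simp
next
  case (plus_single f m a)
  have "Poly_Mapping.keys (f + Poly_Mapping.single m a) = insert m (Poly_Mapping.keys f)"
    using plus_single.hyps
    by (auto simp: in_keys_iff lookup_add lookup_single when_def split: if_splits)
  with plus_single.prems have "Poly_Mapping.keys m \<subseteq> C" and f: "vars f \<subseteq> C"
    by (auto simp: vars_def)
  from this(1) have "P (Poly_Mapping.single m 1)"
  proof (induction m rule: poly_mapping_plus_single_induct)
    case zero
    show ?case by (rule const)
  next
    case (plus_single m c n)
    have "Poly_Mapping.keys (m + Poly_Mapping.single c n) = insert c (Poly_Mapping.keys m)"
      using plus_single.hyps
      by (auto simp: in_keys_iff lookup_add lookup_single when_def split: if_splits)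
    with plus_single.prems have c: "c \<in> C" and m: "Poly_Mapping.keys m \<subseteq> C" by auto
    have "P (Poly_Mapping.single (Poly_Mapping.single c n) 1)"
    proof (induction n)
      case 0
      show ?case using const[of 1] by simp
    next
      case (Suc n)
      have "Poly_Mapping.single (Poly_Mapping.single c (Suc n)) 1 =
          indet c * Poly_Mapping.single (Poly_Mapping.single c n) 1"
        by (simp add: indet_def mult_single flip: single_add)
      with mult[OF indet[OF c] Suc.IH] show ?case by simp
    qed
    with mult[OF plus_single.IH[OF m] this] show ?case by (simp add: mult_single)
  qed
  with mult[OF const[of a] this] have "P (Poly_Mapping.single m a)" by (simp add: mult_single)
  with add[OF plus_single.IH[OF f]] show ?case by blast
qed

lemma toric_ideal_ideal: "ideal (toric_ideal I J M) (table_ring I J)"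
proof -
  interpret cring "table_ring I J" by (rule table_ring_cring)
  have closed: "vars (f + g) \<subseteq> cells I J" "vars (f * g) \<subseteq> cells I J"
    if "vars f \<subseteq> cells I J" "vars g \<subseteq> cells I J" for f g
    using that vars_add[of f g] vars_mult[of f g] by blast+
  have "subgroup (toric_ideal I J M) (add_monoid (table_ring I J))"
    by (rule add.subgroupI)
      (auto simp: toric_ideal_def closed table_ring_uminus simp flip: a_inv_def intro!: exI[of _ 0])
  then show ?thesis
    by (rule idealI[OF ring_axioms]) (auto simp: toric_ideal_def closed)
qed

text \<open>
  The polynomial \<open>g\<close> is the result of the substitution \<open>p\<^sub>c \<mapsto> p\<^bsub>\<phi> c\<^esub>\<close> in \<open>f\<close>, described by its
  values only. It exists because the polynomials \<open>f\<close> for which there is such a decomposition contain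
  the constants and the indeterminates and are closed under sums and products, the latter since
  \<open>(g + k) (g' + k') = g g' + (g k' + k f')\<close> where \<open>f' = g' + k'\<close>.
\<close>

lemma substitute_modulo_binomials:
  assumes K: "ideal K (table_ring I J)"
    and cells: "\<And>c. c \<in> cells I J \<Longrightarrow> \<phi> c \<in> cells I J"
    and binomials: "\<And>c. c \<in> cells I J \<Longrightarrow> indet c - indet (\<phi> c) \<in> K"
    and f: "vars f \<subseteq> cells I J"
  shows "\<exists>g k. f = g + k \<and> vars g \<subseteq> cells I J \<and> k \<in> K \<and>
    (\<forall>x. poly_eval x g = poly_eval (x \<circ> \<phi>) f)"
  using f
proof (induction f rule: vars_induct)
  case (const a)
  from ideal_table_ring_zero[OF K] show ?case
    by (intro exI[of _ "Poly_Mapping.single 0 a"] exI[of _ "0 :: mpoly"])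
      (simp add: vars_def monomial_value_def)
next
  case (indet c)
  with cells binomials show ?case
    by (intro exI[of _ "indet (\<phi> c)"] exI[of _ "indet c - indet (\<phi> c)"]) simp
next
  case (add f f')
  from add obtain g k g' k' where *: "f = g + k" "f' = g' + k'"
    "vars g \<subseteq> cells I J" "k \<in> K" "\<forall>x. poly_eval x g = poly_eval (x \<circ> \<phi>) f"
    "vars g' \<subseteq> cells I J" "k' \<in> K" "\<forall>x. poly_eval x g' = poly_eval (x \<circ> \<phi>) f'"
    by blast
  have "vars (g + g') \<subseteq> cells I J" using * vars_add[of g g'] by blast
  moreover have "k + k' \<in> K" using * by (intro ideal_table_ring_add[OF K])
  moreover have "poly_eval x (g + g') = poly_eval (x \<circ> \<phi>) (f + f')" for x
    using *(5,8) by (simp only: poly_eval_add)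
  moreover have "f + f' = (g + g') + (k + k')" using *(1,2) by (simp add: algebra_simps)
  ultimately show ?case by blast
next
  case (mult f f')
  interpret K: ideal K "table_ring I J" by (rule K)
  from mult obtain g k g' k' where *: "f = g + k" "f' = g' + k'"
    "vars g \<subseteq> cells I J" "k \<in> K" "\<forall>x. poly_eval x g = poly_eval (x \<circ> \<phi>) f"
    "vars g' \<subseteq> cells I J" "k' \<in> K" "\<forall>x. poly_eval x g' = poly_eval (x \<circ> \<phi>) f'"
    by blast
  have "vars k' \<subseteq> cells I J" using K.Icarr[OF *(7)] by simp
  then have "vars f' \<subseteq> cells I J" using * vars_add[of g' k'] by blast
  then have "g * k' + k * f' \<in> K"
    using K.I_l_closed[of k' g] K.I_r_closed[of k f'] *
    by (intro ideal_table_ring_add[OF K]) simp_all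
  moreover have "vars (g * g') \<subseteq> cells I J" using * vars_mult[of g g'] by blast
  moreover have "poly_eval x (g * g') = poly_eval (x \<circ> \<phi>) (f * f')" for x
    using *(5,8) by (simp only: poly_eval_mult)
  moreover have "f * f' = (g * g') + (g * k' + k * f')" using *(1,2) by (simp add: algebra_simps)
  ultimately show ?case by blast
qed

section \<open>Summing two columns\<close>

text \<open>
  Equating the parameters \<open>\<zeta> s\<close> and \<open>\<zeta> s'\<close> turns \<open>\<zeta> s ^ m * \<zeta> s' ^ m'\<close> into \<open>\<zeta> s ^ (m + m')\<close>, the
  contribution of the summed column. The parameters of the two matrices are numbered differently,
  so only the images are compared, which is all that a toric ideal depends on.
\<close>

lemma range_monomial_map_sum_columns:
  assumes s: "s < length M" and s': "s' < length M" and "s \<noteq> s'"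
  shows "range (monomial_map (sum_columns s s' M)) = monomial_map M ` {\<zeta>. \<zeta> s = \<zeta> s'}"
proof -
  define ts where "ts = nths [0..<length M] (- {s, s'})"
  have set_ts: "set ts = {..<length M} - {s, s'}"
    by (force simp: ts_def set_nths)
  have "distinct ts" by (simp add: ts_def)
  then have bij: "bij_betw ((!) ts) {..<length ts} (set ts)"
    by (rule bij_betw_nth) simp_all
  have "nths M (- {s, s'}) = nths (map ((!) M) [0..<length M]) (- {s, s'})"
    by (simp only: map_nth)
  then have cols: "sum_columns s s' M = (\<lambda>c. (M ! s) c + (M ! s') c) # map ((!) M) ts"
    by (simp add: sum_columns_def ts_def nths_map)
  \<comment> \<open>Parameter \<open>0\<close> of the summed matrix belongs to the sum, and parameter \<open>Suc k\<close> to column \<open>ts ! k\<close> of \<open>M\<close>.\<close>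
  have eq: "monomial_map (sum_columns s s' M) \<xi> = monomial_map M \<zeta>"
    if "\<zeta> s = \<xi> 0" "\<zeta> s' = \<xi> 0" "\<And>k. k < length ts \<Longrightarrow> \<zeta> (ts ! k) = \<xi> (Suc k)" for \<xi> \<zeta>
  proof
    fix c
    have "monomial_map (sum_columns s s' M) \<xi> c =
        \<xi> 0 ^ ((M ! s) c + (M ! s') c) * (\<Prod>k < length ts. \<xi> (Suc k) ^ (M ! (ts ! k)) c)"
      by (simp add: monomial_map_def cols prod.lessThan_Suc_shift del: prod.lessThan_Suc)
    also have "(\<Prod>k < length ts. \<xi> (Suc k) ^ (M ! (ts ! k)) c) =
        (\<Prod>k < length ts. \<zeta> (ts ! k) ^ (M ! (ts ! k)) c)"
      using that(3) by (intro prod.cong) auto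
    also have "\<dots> = (\<Prod>t \<in> set ts. \<zeta> t ^ (M ! t) c)"
      by (rule prod.reindex_bij_betw[OF bij])
    also have "\<xi> 0 ^ ((M ! s) c + (M ! s') c) = (\<Prod>t \<in> {s, s'}. \<zeta> t ^ (M ! t) c)"
      using that(1,2) \<open>s \<noteq> s'\<close> by (simp add: power_add)
    also have "(\<Prod>t \<in> {s, s'}. \<zeta> t ^ (M ! t) c) * (\<Prod>t \<in> set ts. \<zeta> t ^ (M ! t) c) =
        (\<Prod>t \<in> {s, s'} \<union> set ts. \<zeta> t ^ (M ! t) c)"
      by (rule prod.union_disjoint[symmetric]) (auto simp: set_ts)
    also have "{s, s'} \<union> set ts = {..<length M}"
      using s s' by (auto simp: set_ts)
    finally show "monomial_map (sum_columns s s' M) \<xi> c = monomial_map M \<zeta> c"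
      by (simp add: monomial_map_def)
  qed
  show ?thesis
  proof (intro equalityI subsetI)
    fix x assume "x \<in> range (monomial_map (sum_columns s s' M))"
    then obtain \<xi> where x: "x = monomial_map (sum_columns s s' M) \<xi>" by blast
    define \<zeta> where "\<zeta> t = (if t \<in> {s, s'} then \<xi> 0
      else \<xi> (Suc (inv_into {..<length ts} ((!) ts) t)))" for t
    have "ts ! k \<notin> {s, s'}" if "k < length ts" for k
      using nth_mem[OF that] set_ts by auto
    then have "x = monomial_map M \<zeta>"
      unfolding x using bij by (intro eq) (auto simp: \<zeta>_def bij_betw_def inv_into_f_f)
    moreover have "\<zeta> s = \<zeta> s'" by (simp add: \<zeta>_def)
    ultimately show "x \<in> monomial_map M ` {\<zeta>. \<zeta> s = \<zeta> s'}" by blast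
  next
    fix x assume "x \<in> monomial_map M ` {\<zeta>. \<zeta> s = \<zeta> s'}"
    then obtain \<zeta> where x: "x = monomial_map M \<zeta>" and "\<zeta> s = \<zeta> s'" by blast
    then have "x = monomial_map (sum_columns s s' M) (case_nat (\<zeta> s) (\<lambda>k. \<zeta> (ts ! k)))"
      unfolding x by (intro eq[symmetric]) simp_all
    then show "x \<in> range (monomial_map (sum_columns s s' M))" by blast
  qed
qed

lemma toric_ideal_sum_columns_iff:
  assumes "s < length M" "s' < length M" "s \<noteq> s'"
  shows "f \<in> toric_ideal I J (sum_columns s s' M) \<longleftrightarrow> vars f \<subseteq> cells I J \<and>
    (\<forall>\<zeta>. \<zeta> s = \<zeta> s' \<longrightarrow> poly_eval (monomial_map M \<zeta>) f = 0)"
proof -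
  have "(\<forall>\<zeta>. poly_eval (monomial_map (sum_columns s s' M) \<zeta>) f = 0) \<longleftrightarrow>
      (\<forall>x \<in> range (monomial_map (sum_columns s s' M)). poly_eval x f = 0)"
    by blast
  then show ?thesis
    unfolding range_monomial_map_sum_columns[OF assms] by (auto simp: toric_ideal_def)
qed

text \<open>
  The assumptions on \<open>\<phi>\<close> say that its effect on a point \<open>monomial_map M \<zeta>\<close> is to replace \<open>\<zeta> s\<close> by
  \<open>\<zeta> s'\<close>. So \<open>\<phi>\<close> carries the whole image of \<open>M\<close> into the image of the summed matrix, and fixes the
  latter pointwise. The first property puts the substituted polynomial of a member of the larger
  ideal into the toric ideal of \<open>M\<close>, the second makes the binomials vanish.
\<close>

lemma toric_ideal_sum_columns:
  assumes s: "s < length M" and s': "s' < length M" and "s \<noteq> s'"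
    and cells: "\<And>c. c \<in> cells I J \<Longrightarrow> \<phi> c \<in> cells I J"
    and col_s: "\<And>c. c \<in> cells I J \<Longrightarrow> (M ! s) (\<phi> c) = 0"
    and col_s': "\<And>c. c \<in> cells I J \<Longrightarrow> (M ! s') (\<phi> c) = (M ! s) c + (M ! s') c"
    and col_other: "\<And>t c. t < length M \<Longrightarrow> t \<noteq> s \<Longrightarrow> t \<noteq> s' \<Longrightarrow> c \<in> cells I J \<Longrightarrow>
      (M ! t) (\<phi> c) = (M ! t) c"
  shows "toric_ideal I J (sum_columns s s' M) = toric_ideal I J M <+>\<^bsub>table_ring I J\<^esub>
    Idl\<^bsub>table_ring I J\<^esub> {indet c - indet (\<phi> c) |c. c \<in> cells I J}"
proof -
  interpret cring "table_ring I J" by (rule table_ring_cring)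
  let ?B = "{indet c - indet (\<phi> c) |c. c \<in> cells I J}"
  let ?K = "Idl\<^bsub>table_ring I J\<^esub> ?B"
  note sum_iff = toric_ideal_sum_columns_iff[OF s s' \<open>s \<noteq> s'\<close>]
  have phi: "monomial_map M \<zeta> (\<phi> c) = monomial_map M (\<zeta>(s := \<zeta> s')) c" if c: "c \<in> cells I J" for \<zeta> c
  proof -
    have split: "(\<Prod>t < length M. h t) = h s * h s' * (\<Prod>t \<in> {..<length M} - {s, s'}. h t)"
      for h :: "nat \<Rightarrow> real"
    proof -
      have "(\<Prod>t < length M. h t) = (\<Prod>t \<in> {..<length M} - {s, s'}. h t) * (\<Prod>t \<in> {s, s'}. h t)"
        using s s' by (intro prod.subset_diff) auto
      then show ?thesis using \<open>s \<noteq> s'\<close> by simp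
    qed
    have "(\<Prod>t \<in> {..<length M} - {s, s'}. \<zeta> t ^ (M ! t) (\<phi> c)) =
        (\<Prod>t \<in> {..<length M} - {s, s'}. (\<zeta>(s := \<zeta> s')) t ^ (M ! t) c)"
      using col_other[OF _ _ _ c] by (intro prod.cong) auto
    then show ?thesis
      unfolding monomial_map_def split
      using \<open>s \<noteq> s'\<close> by (simp add: col_s[OF c] col_s'[OF c] power_add)
  qed
  have "vars (indet c - indet (\<phi> c)) \<subseteq> cells I J" if "c \<in> cells I J" for c
    using that cells[OF that] vars_diff[of "indet c" "indet (\<phi> c)"] by auto
  then have B: "?B \<subseteq> carrier (table_ring I J)" by auto
  have K: "ideal ?K (table_ring I J)" using B by (rule genideal_ideal)
  show ?thesis
  proof (intro equalityI subsetI)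
    fix f assume f: "f \<in> toric_ideal I J (sum_columns s s' M)"
    then have vars_f: "vars f \<subseteq> cells I J" by (simp add: sum_iff)
    have "indet c - indet (\<phi> c) \<in> ?K" if "c \<in> cells I J" for c
      using that genideal_self[OF B] by blast
    from substitute_modulo_binomials[OF K cells this vars_f]
    obtain g k where gk: "f = g + k" "vars g \<subseteq> cells I J" "k \<in> ?K"
      "\<And>x. poly_eval x g = poly_eval (x \<circ> \<phi>) f"
      by blast
    \<comment> \<open>The parameters \<open>\<zeta>\<close> are arbitrary here: after the substitution they need not agree at \<open>s\<close> and \<open>s'\<close>.\<close>
    have "poly_eval (monomial_map M \<zeta>) g = 0" for \<zeta>
    proof -
      have "poly_eval (monomial_map M \<zeta>) g = poly_eval (monomial_map M (\<zeta>(s := \<zeta> s'))) f"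
        unfolding gk(4) using vars_f phi by (intro poly_eval_cong) auto
      also have "\<dots> = 0" using f \<open>s \<noteq> s'\<close> by (simp add: sum_iff)
      finally show ?thesis .
    qed
    with gk(2) have "g \<in> toric_ideal I J M" by (simp add: toric_ideal_def)
    with gk show "f \<in> toric_ideal I J M <+>\<^bsub>table_ring I J\<^esub> ?K"
      by (auto simp: set_add_def')
  next
    fix f assume "f \<in> toric_ideal I J M <+>\<^bsub>table_ring I J\<^esub> ?K"
    then obtain g k where f: "f = g + k" and g: "g \<in> toric_ideal I J M" and k: "k \<in> ?K"
      by (auto simp: set_add_def')
    have "?B \<subseteq> toric_ideal I J (sum_columns s s' M)"
    proof
      fix h assume "h \<in> ?B"
      then obtain c where c: "c \<in> cells I J" "h = indet c - indet (\<phi> c)" by blast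
      have "\<zeta>(s := \<zeta> s') = \<zeta>" if "\<zeta> s = \<zeta> s'" for \<zeta> :: "nat \<Rightarrow> real"
        using that by (auto simp: fun_upd_idem)
      moreover have "vars h \<subseteq> cells I J"
        using subsetD[OF B \<open>h \<in> ?B\<close>] by (simp only: table_ring_simps)
      ultimately show "h \<in> toric_ideal I J (sum_columns s s' M)"
        using c by (simp add: sum_iff phi)
    qed
    then have "?K \<subseteq> toric_ideal I J (sum_columns s s' M)"
      by (rule genideal_minimal[OF toric_ideal_ideal])
    moreover have "g \<in> toric_ideal I J (sum_columns s s' M)"
      using g unfolding sum_iff by (simp add: toric_ideal_def)
    ultimately show "f \<in> toric_ideal I J (sum_columns s s' M)"
      unfolding f using k by (intro ideal_table_ring_add[OF toric_ideal_ideal]) auto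
  qed
qed

theorem proposition12:
  fixes I J s s' :: nat
  assumes "I > 0" and "J > 0"
    and "s \<noteq> s'"
    and "{s, s'} \<subseteq> {1..I} \<or> {s, s'} \<subseteq> {I + 1..I + J}"
  shows "\<exists>K B. B \<subseteq> linear_binomials I J \<and> K = Idl\<^bsub>table_ring I J\<^esub> B \<and>
    toric_ideal I J (sum_columns s s' (independence_matrix I J)) =
      toric_ideal I J (independence_matrix I J) <+>\<^bsub>table_ring I J\<^esub> K \<and>
    (\<forall>a \<in> {1..J}. \<forall>b \<in> {1..J}. s = I + a \<and> s' = I + b \<longrightarrow>
      (\<forall>i \<in> {1..I}. indet (i, a) - indet (i, b) \<in> K))"
proof -
  \<comment> \<open>Move every cell of the row or column of the table belonging to \<open>s\<close> to that of \<open>s'\<close>;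
    positions beyond \<open>I\<close> belong to the columns of the table.\<close>
  define \<phi> :: "cell \<Rightarrow> cell" where "\<phi> c =
    (if s \<le> I then (if fst c = s then s' else fst c, snd c)
     else (fst c, if snd c = s - I then s' - I else snd c))" for c
  let ?A = "independence_matrix I J"
  let ?B = "{indet c - indet (\<phi> c) |c. c \<in> cells I J}"
  let ?K = "Idl\<^bsub>table_ring I J\<^esub> ?B"
  have len: "s < length ?A" "s' < length ?A"
    using assms(4) by (auto simp: independence_matrix_nth(1))
  have rows: "?A ! t = row_indicator t" if "t \<in> {1..I}" for t
    using that by (rule independence_matrix_nth(3))
  have columns: "?A ! t = column_indicator (t - I)" if "t \<in> {I + 1..I + J}" for t
    using that independence_matrix_nth(4)[of "t - I" J I] by fastforce
  have cells: "\<phi> c \<in> cells I J" if "c \<in> cells I J" for c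
    using that assms(4) by (auto simp: \<phi>_def cells_def)
  have summed: "(?A ! s) (\<phi> c) = 0" "(?A ! s') (\<phi> c) = (?A ! s) c + (?A ! s') c" for c
    using assms(3,4)
    by (auto simp: rows columns \<phi>_def row_indicator_def column_indicator_def)
  have other: "(?A ! t) (\<phi> c) = (?A ! t) c"
    if "t < length ?A" "t \<noteq> s" "t \<noteq> s'" for t c
  proof -
    have "t = 0 \<or> t \<in> {1..I} \<or> t \<in> {I + 1..I + J}"
      using that(1) by (auto simp: independence_matrix_nth(1))
    then show ?thesis
      using that(2,3) assms(4)
      by (elim disjE) (auto simp: independence_matrix_nth(2) rows columns \<phi>_def
          row_indicator_def column_indicator_def)
  qed
  have sum: "toric_ideal I J (sum_columns s s' ?A) = toric_ideal I J ?A <+>\<^bsub>table_ring I J\<^esub> ?K"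
    by (rule toric_ideal_sum_columns) (use len assms(3) cells summed other in auto)
  have lin: "?B \<subseteq> linear_binomials I J"
    unfolding linear_binomials_def using cells by blast
  have "indet (i, a) - indet (i, b) \<in> ?K"
    if "a \<in> {1..J}" "s = I + a" "s' = I + b" "i \<in> {1..I}" for a b i
  proof -
    have "(i, a) \<in> cells I J" "\<phi> (i, a) = (i, b)"
      using that by (auto simp: \<phi>_def cells_def)
    then have "indet (i, a) - indet (i, b) \<in> ?B" by force
    then show ?thesis by (auto simp: genideal_def)
  qed
  with lin sum show ?thesis
    by (intro exI[of _ ?K] exI[of _ ?B]) auto
qed

end
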